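(* Let $N\geq 2$ and, for $\alpha\in\mathbb{R}$, let $u_\alpha$ be the radial function on $\mathbb{R}^N\setminus B_1$ given by $u_\alpha(r)=r^\alpha$ for $r\geq 1$ if $\alpha\neq 0$, and $u_0(r)=\log r$ for $r\geq 1$. Then $u_\alpha$, as a solution of $-\Delta u=f_\alpha(u)$ in $\mathbb{R}^N\setminus B_1$ with the functions $f_\alpha\in C^1(\mathbb{R})$ given in the context, is stable if and only if $$\alpha\geq -N/2+\sqrt{N-1}+2\quad\text{or}\quad\alpha\leq -N/2-\sqrt{N-1}+2.$$
   Context: $B_1$ is the open unit ball of $\mathbb{R}^N$, so $\mathbb{R}^N\setminus B_1=\{x:|x|\geq 1\}$. For radial $u$ one writes $u(r)$ for $u(x)$ with $r=|x|$. The functions $f_\alpha$ are: - if $\alpha<0$: $f_\alpha(s)=-\alpha(\alpha+N-2)s^{1-2/\alpha}$ for $s>0$ and $f_\alpha(s)=0$ for $s\leq 0$; - if $\alpha>0$: $f_\alpha(s)=-\alpha(\alpha+N-2)s^{1-2/\alpha}$ for $s\geq 1$ and $f_\alpha(s)=(\alpha+N-2)\left((2-\alpha)s-2\right)$ for $s<1$; - $f_0(s)=-(N-2)e^{-2s}$ for $s\in\mathbb{R}$. Each $f_\alpha$ is $C^1$ and $u_\alpha$ solves $-\Delta u_\alpha=f_\alpha(u_\alpha)$ in $\mathbb{R}^N\setminus B_1$. A solution $u$ of $-\Delta u=f(u)$ in $\mathbb{R}^N\setminus B_1$ is called stable if $\int_{\mathbb{R}^N\setminus\overline{B_1}}\left(|\nabla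 v|^2-f'(u)v^2\right)dx\geq 0$ for every $v\in C^1(\mathbb{R}^N\setminus\overline{B_1})$ with compact support in $\mathbb{R}^N\setminus\overline{B_1}$. *)

theory Defs
  imports "HOL-Analysis.Analysis"
begin

text \<open>
  Derivatives are taken relative to a set \<open>S\<close>, so that regularity on the closed exterior domain is
  regularity up to the boundary and does not depend on the values of the function inside the ball.
  In this domain, as in an open set, the relative derivative at each point is unique.
\<close>

definition gradient_within :: "('a::euclidean_space \<Rightarrow> real) \<Rightarrow> 'a set \<Rightarrow> 'a \<Rightarrow> 'a" where
  "gradient_within u S x = (\<Sum>b\<in>Basis. frechet_derivative u (at x within S) b *\<^sub>R b)"

definition laplacian_within :: "('a::euclidean_space \<Rightarrow> real) \<Rightarrow> 'a set \<Rightarrow> 'a \<Rightarrow> real" where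
  "laplacian_within u S x =
     (\<Sum>b\<in>Basis. frechet_derivative (gradient_within u S) (at x within S) b \<bullet> b)"

definition C1_on :: "('a::euclidean_space \<Rightarrow> real) \<Rightarrow> 'a set \<Rightarrow> bool" where
  "C1_on u S \<longleftrightarrow> u differentiable_on S \<and> continuous_on S (gradient_within u S)"

definition C2_on :: "('a::euclidean_space \<Rightarrow> real) \<Rightarrow> 'a set \<Rightarrow> bool" where
  "C2_on u S \<longleftrightarrow> C1_on u S \<and> gradient_within u S differentiable_on S \<and>
     (\<forall>b\<in>Basis. continuous_on S (\<lambda>x. frechet_derivative (gradient_within u S) (at x within S) b))"

definition closed_exterior :: "'a::euclidean_space set" where
  "closed_exterior = - ball 0 1"

definition open_exterior :: "'a::euclidean_space set" where
  "open_exterior = - cball 0 1"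

definition exterior_solution :: "(real \<Rightarrow> real) \<Rightarrow> ('a::euclidean_space \<Rightarrow> real) \<Rightarrow> bool" where
  "exterior_solution f u \<longleftrightarrow> C2_on u closed_exterior \<and>
     (\<forall>x\<in>closed_exterior. - laplacian_within u closed_exterior x = f (u x))"

definition test_function :: "('a::euclidean_space \<Rightarrow> real) \<Rightarrow> bool" where
  "test_function v \<longleftrightarrow> C1_on v open_exterior \<and>
     compact (closure (support_on open_exterior v)) \<and>
     closure (support_on open_exterior v) \<subseteq> open_exterior"

definition stable_solution :: "(real \<Rightarrow> real) \<Rightarrow> ('a::euclidean_space \<Rightarrow> real) \<Rightarrow> bool" where
  "stable_solution f u \<longleftrightarrow> exterior_solution f u \<and>
     (\<forall>v. test_function v \<longrightarrow>
        0 \<le> (LINT x:open_exterior|lborel.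
               (norm (gradient_within v open_exterior x))\<^sup>2 - deriv f (u x) * (v x)\<^sup>2))"

definition f_alpha :: "nat \<Rightarrow> real \<Rightarrow> real \<Rightarrow> real" where
  "f_alpha N \<alpha> s =
     (if \<alpha> < 0 then
        (if s > 0 then - \<alpha> * (\<alpha> + real N - 2) * s powr (1 - 2 / \<alpha>) else 0)
      else if \<alpha> > 0 then
        (if s \<ge> 1 then - \<alpha> * (\<alpha> + real N - 2) * s powr (1 - 2 / \<alpha>)
         else (\<alpha> + real N - 2) * ((2 - \<alpha>) * s - 2))
      else - (real N - 2) * exp (- 2 * s))"

text \<open>Only the values at points of norm at least 1 are relevant.\<close>

definition u_alpha :: "real \<Rightarrow> 'a::euclidean_space \<Rightarrow> real" where
  "u_alpha \<alpha> x = (if \<alpha> = 0 then ln (norm x) else norm x powr \<alpha>)"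

end

theory Submission
  imports Defs
begin

text \<open>
  With \<open>c = (\<alpha> - 2) (\<alpha> + N - 2)\<close> one has \<open>f_\<alpha>'(u_\<alpha>(x)) = - c / |x|\<^sup>2\<close>, so stability is the
  inequality \<open>\<integral> |\<nabla>v|\<^sup>2 + c v\<^sup>2 / |x|\<^sup>2 \<ge> 0\<close>, and the claim is that the best constant in Hardy's
  inequality on the exterior domain is \<open>m\<^sup>2\<close> with \<open>m = (N - 2) / 2\<close>. Both directions compare the
  integrand with an expression \<open>x \<cdot> \<nabla>g + N g = div (g x)\<close>, whose integral vanishes for compactly
  supported \<open>g\<close>. For the lower bound take \<open>g = v\<^sup>2 / |x|\<^sup>2\<close> and complete the square. If
  \<open>c + m\<^sup>2 < 0\<close>, take \<open>v = |x|\<^sup>-\<^sup>m b(t)\<^sup>2\<close> with \<open>t = \<epsilon> ln |x| - 2\<close> and \<open>b(t) = max 0 (1 - t\<^sup>2)\<close>: for a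
  suitable \<open>g\<close> the integrand is \<open>(3 \<epsilon>\<^sup>2 + m\<^sup>2 + c) |x|\<^sup>-\<^sup>N b(t)\<^sup>4\<close> plus \<open>div (g x)\<close>, so that no polar
  coordinates are needed.
\<close>

section \<open>Derivatives relative to a set\<close>

text \<open>A derivative within \<open>S\<close> is unique as soon as \<open>x\<close> can be
  approached inside \<open>S\<close> along each coordinate axis. The sign of \<open>d\<close> is
  free, so one side of each axis suffices and boundary points of the closed exterior are
  covered.\<close>

lemma frechet_derivative_within_eqI:
  fixes f :: "'a::euclidean_space \<Rightarrow> 'b::real_normed_vector"
  assumes "(f has_derivative D) (at x within S)"
    and "\<And>i e. \<lbrakk>i \<in> Basis; e > 0\<rbrakk> \<Longrightarrow> \<exists>d. 0 < \<bar>d\<bar> \<and> \<bar>d\<bar> < e \<and> x + d *\<^sub>R i \<in> S"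
  shows "frechet_derivative f (at x within S) = D"
proof -
  have "(f has_derivative frechet_derivative f (at x within S)) (at x within S)"
    using assms(1) by (meson differentiableI frechet_derivative_works)
  from frechet_derivative_unique_within[OF this assms(1)] show ?thesis
    using assms(2) by blast
qed

lemma gradient_within_eqI:
  assumes "(u has_derivative (\<lambda>h. g \<bullet> h)) (at x within S)"
    and "\<And>i e. \<lbrakk>i \<in> Basis; e > 0\<rbrakk> \<Longrightarrow> \<exists>d. 0 < \<bar>d\<bar> \<and> \<bar>d\<bar> < e \<and> x + d *\<^sub>R i \<in> S"
  shows "gradient_within u S x = g"
proof -
  have "frechet_derivative u (at x within S) = (\<lambda>h. g \<bullet> h)"
    using frechet_derivative_within_eqI[OF assms(1)] assms(2) by blast
  then show ?thesis
    by (simp add: gradient_within_def euclidean_representation)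
qed

lemma segment_in_open:
  fixes x :: "'a::euclidean_space"
  assumes "open S" "x \<in> S" "i \<in> Basis" "e > 0"
  shows "\<exists>d. 0 < \<bar>d\<bar> \<and> \<bar>d\<bar> < e \<and> x + d *\<^sub>R i \<in> S"
proof -
  obtain r where r: "r > 0" "ball x r \<subseteq> S"
    using assms openE by blast
  have "x + (min r e / 2) *\<^sub>R i \<in> ball x r"
    using r assms by (auto simp: dist_norm)
  then show ?thesis
    using r assms by (intro exI[of _ "min r e / 2"]) auto
qed

text \<open>Moving along \<open>i\<close> in the direction given by the sign of
  \<open>x \<bullet> i\<close> does not decrease the norm, so the step stays outside the ball even
  when \<open>x\<close> lies on the unit sphere.\<close>

lemma segment_in_closed_exterior:
  fixes x :: "'a::euclidean_space"
  assumes "x \<in> closed_exterior" "i \<in> Basis" "e > 0"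
  shows "\<exists>d. 0 < \<bar>d\<bar> \<and> \<bar>d\<bar> < e \<and> x + d *\<^sub>R i \<in> closed_exterior"
proof -
  define d where "d = (if x \<bullet> i \<ge> 0 then e / 2 else - (e / 2))"
  have "0 \<le> d * (x \<bullet> i)"
    using \<open>e > 0\<close> by (auto simp: d_def mult_pos_neg less_imp_le)
  then have "(norm x)\<^sup>2 \<le> (norm (x + d *\<^sub>R i))\<^sup>2"
    unfolding power2_norm_eq_inner using assms
    by (simp add: inner_add inner_commute)
  then have "x + d *\<^sub>R i \<in> closed_exterior"
    using assms(1) by (auto simp: closed_exterior_def dest: power2_le_imp_le)
  then show ?thesis
    using \<open>e > 0\<close> by (intro exI[of _ d]) (auto simp: d_def)
qed

lemma open_open_exterior: "open (open_exterior :: 'a::euclidean_space set)"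
  unfolding open_exterior_def by (intro open_Compl closed_cball)

lemma has_derivative_gradient_within:
  fixes u :: "'a::euclidean_space \<Rightarrow> real"
  assumes "u differentiable (at x within S)"
  shows "(u has_derivative (\<lambda>h. gradient_within u S x \<bullet> h)) (at x within S)"
proof -
  let ?D = "frechet_derivative u (at x within S)"
  have D: "(u has_derivative ?D) (at x within S)"
    using assms by (simp add: frechet_derivative_works)
  then interpret linear ?D
    using has_derivative_linear by blast
  have "?D h = gradient_within u S x \<bullet> h" for h
  proof -
    have "?D h = ?D (\<Sum>b\<in>Basis. (h \<bullet> b) *\<^sub>R b)"
      by (simp add: euclidean_representation)
    then show ?thesis
      by (simp add: gradient_within_def sum scale inner_sum_left inner_sum_right inner_commute mult.commute)
  qed
  then show ?thesis
    using D by presburger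
qed

section \<open>Radial functions and the equation solved by \<open>u_alpha\<close>\<close>

lemma has_derivative_radial:
  fixes x :: "'a::real_inner"
  assumes "(\<phi> has_real_derivative d) (at (norm x))" "x \<noteq> 0"
  shows "((\<lambda>x. \<phi> (norm x)) has_derivative (\<lambda>h. (d / norm x) *\<^sub>R x \<bullet> h)) (at x within S)"
proof -
  have "(norm has_derivative (\<lambda>h. sgn x \<bullet> h)) (at x within S)"
    using has_derivative_at_withinI[OF has_derivative_norm[OF assms(2)]]
    by (simp add: inner_commute)
  from has_derivative_compose[OF this assms(1)[unfolded has_field_derivative_def]]
  show ?thesis
    by (simp add: sgn_div_norm divide_inverse mult.assoc inner_commute)
qed

lemma has_derivative_norm_powr:
  fixes x :: "'a::real_inner"
  assumes "x \<noteq> 0"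
  shows "((\<lambda>x. norm x powr a) has_derivative (\<lambda>h. (a * norm x powr (a - 2)) *\<^sub>R x \<bullet> h)) (at x within S)"
proof -
  have "norm x powr (a - 1) / norm x = norm x powr (a - 2)"
    using assms powr_diff[of "norm x" "a-1" 1] by simp
  then show ?thesis
    using has_derivative_radial[OF has_real_derivative_powr, of x a S] assms
    by (simp add: divide_inverse mult.assoc)
qed

lemma has_derivative_ln_norm:
  fixes x :: "'a::real_inner"
  assumes "x \<noteq> 0"
  shows "((\<lambda>x. ln (norm x)) has_derivative (\<lambda>h. (norm x powr -2) *\<^sub>R x \<bullet> h)) (at x within S)"
proof -
  have "(ln has_real_derivative inverse (norm x)) (at (norm x))"
    using assms by (intro DERIV_ln) auto
  moreover have "inverse (norm x) / norm x = norm x powr -2"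
    using assms by (simp add: powr_minus divide_inverse power2_eq_square)
  ultimately show ?thesis
    using has_derivative_radial[of ln _ x S] assms by metis
qed

lemma exterior_solution_u_alpha:
  "exterior_solution (f_alpha DIM('a) \<alpha>) (u_alpha \<alpha> :: 'a::euclidean_space \<Rightarrow> real)"
proof -
  let ?S = "closed_exterior :: 'a set"
  let ?u = "u_alpha \<alpha> :: 'a \<Rightarrow> real"
  \<comment> \<open>With this \<open>k\<close> the powers and the logarithm share the gradient k
    |x|^(\<alpha> - 2) x, so one computation serves both.\<close>
  define k where "k = (if \<alpha> = 0 then 1 else \<alpha>)"
  define G where "G = (\<lambda>x::'a. (k * norm x powr (\<alpha> - 2)) *\<^sub>R x)"
  define D where "D = (\<lambda>x h::'a. (k * norm x powr (\<alpha> - 2)) *\<^sub>R h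
    + (k * (\<alpha> - 2) * norm x powr (\<alpha> - 4) * (x \<bullet> h)) *\<^sub>R x)"
  have nz: "norm x \<ge> 1" "x \<noteq> 0" if "x \<in> ?S" for x
    using that by (auto simp: closed_exterior_def)
  have u': "(?u has_derivative (\<lambda>h. G x \<bullet> h)) (at x within ?S)" if "x \<in> ?S" for x
    using has_derivative_norm_powr[OF nz(2)[OF that], of \<alpha>] has_derivative_ln_norm[OF nz(2)[OF that]]
    by (cases "\<alpha> = 0") (auto simp: u_alpha_def[abs_def] G_def k_def)
  have grad: "gradient_within ?u ?S x = G x" if "x \<in> ?S" for x
    using gradient_within_eqI[OF u'[OF that] segment_in_closed_exterior[OF that]] by blast
  have G': "(G has_derivative D x) (at x within ?S)" if "x \<in> ?S" for x
    unfolding G_def D_def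
    by (rule has_derivative_eq_rhs[OF has_derivative_scaleR[OF
          has_derivative_mult_right[OF has_derivative_norm_powr[OF nz(2)[OF that]]] has_derivative_ident]])
      (simp add: fun_eq_iff mult.assoc)
  \<comment> \<open>The gradient is known to agree with \<open>G\<close> only on the closed
    exterior, which is enough for a derivative within that set.\<close>
  have grad': "(gradient_within ?u ?S has_derivative D x) (at x within ?S)" if "x \<in> ?S" for x
    by (rule has_derivative_transform[OF that _ G'[OF that]]) (rule grad)
  have fd: "frechet_derivative (gradient_within ?u ?S) (at x within ?S) = D x" if "x \<in> ?S" for x
    using frechet_derivative_within_eqI[OF grad'[OF that] segment_in_closed_exterior[OF that]] by blast
  have "continuous_on ?S G"
    unfolding G_def using nz by (intro continuous_intros) auto
  then have "C1_on ?u ?S"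
    unfolding C1_on_def differentiable_on_def differentiable_def using u' 
    by (auto cong: continuous_on_cong simp: grad)
  moreover have "continuous_on ?S (\<lambda>x. D x b)" for b
    unfolding D_def using nz by (intro continuous_intros) auto
  ultimately have "C2_on ?u ?S"
    unfolding C2_on_def differentiable_on_def differentiable_def using grad' 
    by (auto cong: continuous_on_cong simp: fd)
  moreover have "- laplacian_within ?u ?S x = f_alpha DIM('a) \<alpha> (?u x)" if x: "x \<in> ?S" for x
  proof -
    have 4: "norm x powr (\<alpha> - 4) * (norm x)\<^sup>2 = norm x powr (\<alpha> - 2)"
      using nz[OF x] powr_add[of "norm x" "\<alpha>-4" 2] by (simp add: powr_numeral)
    have "laplacian_within ?u ?S x = (\<Sum>b\<in>Basis. D x b \<bullet> b)"
      by (simp add: laplacian_within_def fd x)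
    also have "\<dots> = k * norm x powr (\<alpha> - 2) * real DIM('a)
       + k * (\<alpha> - 2) * norm x powr (\<alpha> - 4) * (\<Sum>b\<in>Basis. (x \<bullet> b) * (x \<bullet> b))"
      by (simp add: D_def inner_add_left sum.distrib sum_distrib_left mult.assoc)
    also have "(\<Sum>b\<in>Basis. (x \<bullet> b) * (x \<bullet> b)) = (norm x)\<^sup>2"
      by (metis euclidean_inner power2_norm_eq_inner)
    also have "k * norm x powr (\<alpha> - 2) * real DIM('a)
       + k * (\<alpha> - 2) * norm x powr (\<alpha> - 4) * (norm x)\<^sup>2
       = k * (\<alpha> + DIM('a) - 2) * norm x powr (\<alpha> - 2)"
      using 4 by (simp add: algebra_simps)
    finally have L: "laplacian_within ?u ?S x = k * (\<alpha> + DIM('a) - 2) * norm x powr (\<alpha> - 2)" .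
    show ?thesis
    proof (cases "\<alpha> = 0")
      case True
      have "exp (- 2 * ln (norm x)) = norm x powr - 2"
        using nz[OF x] by (simp add: powr_def)
      then show ?thesis
        using True L by (simp add: f_alpha_def u_alpha_def k_def algebra_simps)
    next
      case False
      have "(norm x powr \<alpha>) powr (1 - 2 / \<alpha>) = norm x powr (\<alpha> - 2)"
        using False by (simp add: powr_powr algebra_simps)
      \<comment> \<open>This places the value of \<open>u_alpha\<close> in the branch
        \<open>s \<ge> 1\<close> of \<open>f_alpha\<close>.\<close>
      moreover have "\<alpha> > 0 \<Longrightarrow> norm x powr \<alpha> \<ge> 1"
        using nz[OF x] by (simp add: ge_one_powr_ge_zero)
      ultimately show ?thesis
        using False nz[OF x] by (auto simp: L f_alpha_def u_alpha_def k_def)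
    qed
  qed
  ultimately show ?thesis
    by (simp add: exterior_solution_def)
qed

section \<open>Smoothness of \<open>f_alpha\<close> and its derivative along
  \<open>u_alpha\<close>\<close>

text \<open>Only the origin needs an argument: the difference quotient there is
  \<open>h powr (p - 1)\<close> on the right and 0 on the left, and it tends to 0 because
  \<open>p > 1\<close>. This serves both \<open>f_alpha\<close> for \<alpha> < 0 and the powers of
  the cut-off below.\<close>

lemma DERIV_pos_part_powr:
  fixes p :: real
  assumes "p > 1"
  shows "((\<lambda>s. if s > 0 then s powr p else 0) has_real_derivative
     (if s > 0 then p * s powr (p - 1) else 0)) (at s)"
proof -
  let ?f = "\<lambda>s. if s > 0 then s powr p else (0::real)"
  consider "s > 0" | "s < 0" | "s = 0" by linarith
  then show ?thesis
  proof cases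
    case 1
    have "(?f has_real_derivative p * s powr (p - 1)) (at s)"
      by (rule has_field_derivative_transform_within_open[OF has_real_derivative_powr[OF 1], of "{0<..}"])
        (use 1 in auto)
    then show ?thesis using 1 by simp
  next
    case 2
    have "(?f has_real_derivative 0) (at s)"
      by (rule has_field_derivative_transform_within_open[of "\<lambda>_. 0" _ _ "{..<0}"]) (use 2 in auto)
    then show ?thesis using 2 by simp
  next
    case 3
    have "((\<lambda>h. \<bar>h\<bar> powr (p - 1)) \<longlongrightarrow> 0) (at (0::real))"
      by (rule tendsto_zero_powrI[where b = "p - 1"]) (use assms in \<open>auto intro!: tendsto_eq_intros\<close>)
    then have "((\<lambda>h. (?f (0 + h) - ?f 0) / h) \<longlongrightarrow> 0) (at 0)"
    proof (rule Lim_null_comparison[rotated])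
      show "\<forall>\<^sub>F h in at 0. norm ((?f (0 + h) - ?f 0) / h) \<le> \<bar>h\<bar> powr (p - 1)"
        using eventually_neq_at_within[of 0 0 UNIV]
      proof eventually_elim
        case (elim h)
        then show ?case by (cases "h > 0") (simp add: powr_diff, simp)
      qed
    qed
    then show ?thesis using 3 by (simp add: DERIV_def)
  qed
qed

text \<open>For \<alpha> < 0 the exponent 1 - 2/\<alpha> exceeds 1, so the power meets the zero
  branch with slope 0. For \<alpha> > 0 the affine branch is the tangent of the power at s =
  1.\<close>

lemma f_alpha_C1:
  "f_alpha N \<alpha> C1_differentiable_on UNIV"
proof -
  define p where "p = 1 - 2 / \<alpha>"
  define K where "K = - \<alpha> * (\<alpha> + real N - 2)"
  consider "\<alpha> < 0" | "\<alpha> > 0" | "\<alpha> = 0" by linarith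
  then show ?thesis
  proof cases
    case 1
    then have p: "p > 1" by (simp add: p_def divide_pos_neg field_simps)
    have f: "f_alpha N \<alpha> = (\<lambda>s. K * (if s > 0 then s powr p else 0))"
      using 1 by (auto simp: f_alpha_def fun_eq_iff p_def K_def)
    \<comment> \<open>Since \<open>0 powr a = 0\<close>, the maximum with 0 absorbs the case
      distinction in the derivative.\<close>
    have "continuous_on UNIV (\<lambda>s::real. max 0 s powr (p - 1))"
      by (rule continuous_on_powr'; (intro continuous_intros)?) (use p in auto)
    then have "continuous_on UNIV (\<lambda>s::real. K * (p * max 0 s powr (p - 1)))"
      by (intro continuous_on_mult_left)
    also have "(\<lambda>s::real. K * (p * max 0 s powr (p - 1))) =
        (\<lambda>s. K * (if s > 0 then p * s powr (p - 1) else 0))"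
      by (auto simp: fun_eq_iff max_def)
    finally show ?thesis
      unfolding C1_differentiable_on_def f
      using DERIV_cmult[OF DERIV_pos_part_powr[OF p], of K]
      by (auto simp: has_real_derivative_iff_has_vector_derivative
          intro!: exI[of _ "\<lambda>s. K * (if s > 0 then p * s powr (p - 1) else 0)"])
  next
    case 2
    define D where "D s = (if s \<in> {1..} then K * (p * s powr (p - 1)) else (\<alpha> + real N - 2) * (2 - \<alpha>))" for s
    have Kp: "K * p = (\<alpha> + real N - 2) * (2 - \<alpha>)"
      using 2 by (simp add: K_def p_def field_simps)
    have f: "f_alpha N \<alpha> = (\<lambda>s. if s \<in> {1..} then K * s powr p else (\<alpha> + real N - 2) * ((2 - \<alpha>) * s - 2))"
      using 2 by (auto simp: f_alpha_def fun_eq_iff p_def K_def)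
    have closures: "closure {1..} = {1::real..}" "closure {..<1} = {..1::real}"
      by simp_all
    \<comment> \<open>Each branch is differentiated within its own set enlarged by the common
      boundary point 1.\<close>
    have cl: "{1..} \<union> (closure {1..} \<inter> closure {..<1}) = {1::real..}" 
         "{..<1} \<union> (closure {1..} \<inter> closure {..<1}) = {..(1::real)}"
      unfolding closures by auto
    have "(f_alpha N \<alpha> has_vector_derivative D s) (at s)" for s
      unfolding f D_def
    proof (rule has_vector_derivative_If_within_closures[where T = "{..<1}"], unfold cl)
      show "((\<lambda>s. K * s powr p) has_vector_derivative K * (p * s powr (p - 1))) (at s within {1..})"
        if "s \<in> {1..}"
        using that DERIV_cmult[OF has_real_derivative_powr, of s K p]
        by (auto simp: has_real_derivative_iff_has_vector_derivative[symmetric] intro: has_field_derivative_at_within)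
      show "((\<lambda>s. (\<alpha> + real N - 2) * ((2 - \<alpha>) * s - 2)) has_vector_derivative
         (\<alpha> + real N - 2) * (2 - \<alpha>)) (at s within {..1})"
        unfolding has_real_derivative_iff_has_vector_derivative[symmetric]
        by (auto intro!: derivative_eq_intros)
    qed (use Kp in \<open>auto simp: K_def closures algebra_simps\<close>)
    moreover have "continuous_on UNIV D"
    proof -
      \<comment> \<open>As \<open>1 powr a = 1\<close>, the maximum with 1 freezes the derivative at
        \<open>K * p\<close>, the slope of the affine branch.\<close>
      have "D = (\<lambda>s. K * (p * max 1 s powr (p - 1)))"
        using Kp by (auto simp: D_def fun_eq_iff max_def algebra_simps)
      moreover have "continuous_on UNIV (\<lambda>s. K * (p * max 1 s powr (p - 1)))"
        by (intro continuous_intros) auto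
      ultimately show ?thesis by simp
    qed
    ultimately show ?thesis
      by (auto simp: C1_differentiable_on_def)
  next
    case 3
    have "f_alpha N \<alpha> = (\<lambda>s. - (real N - 2) * exp (- 2 * s))"
      using 3 by (auto simp: f_alpha_def)
    moreover have "((\<lambda>s. - (real N - 2) * exp (- 2 * s)) has_vector_derivative
        2 * (real N - 2) * exp (- 2 * s)) (at s)" for s
      unfolding has_real_derivative_iff_has_vector_derivative[symmetric]
      by (auto intro!: derivative_eq_intros simp: algebra_simps)
    moreover have "continuous_on UNIV (\<lambda>s. 2 * (real N - 2) * exp (- 2 * s))"
      by (intro continuous_intros)
    ultimately show ?thesis
      unfolding C1_differentiable_on_def by metis
  qed
qed

text \<open>The derivative of \<open>f_alpha\<close> is a multiple of s^(-2/\<alpha>), which turns s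
  = |x|^\<alpha> into an inverse-square potential. For \<alpha> = 0 the exponential does the same to
  the logarithm.\<close>

lemma deriv_f_alpha_u_alpha:
  fixes x :: "'a::euclidean_space"
  assumes x: "x \<in> open_exterior"
  shows "deriv (f_alpha N \<alpha>) (u_alpha \<alpha> x) = - ((\<alpha> - 2) * (\<alpha> + real N - 2)) / (norm x)\<^sup>2"
proof -
  define s where "s = u_alpha \<alpha> x"
  have n: "norm x > 1" "x \<noteq> 0"
    using x by (auto simp: open_exterior_def)
  show ?thesis
  proof (cases "\<alpha> = 0")
    case True
    have "f_alpha N \<alpha> = (\<lambda>s. - (real N - 2) * exp (- 2 * s))"
      using True by (auto simp: f_alpha_def)
    moreover have "((\<lambda>s. - (real N - 2) * exp (- 2 * s)) has_real_derivative
        2 * (real N - 2) * exp (- 2 * s)) (at s)"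
      by (auto intro!: derivative_eq_intros simp: algebra_simps)
    moreover have "exp (- 2 * s) = 1 / (norm x)\<^sup>2"
    proof -
      have "exp (- 2 * s) = norm x powr -2"
        using n True by (simp add: s_def u_alpha_def powr_def)
      then show ?thesis using n by (simp add: powr_minus divide_inverse)
    qed
    ultimately have "deriv (f_alpha N \<alpha>) s = 2 * (real N - 2) * (1 / (norm x)\<^sup>2)"
      by (metis DERIV_imp_deriv)
    then show ?thesis
      using True unfolding s_def by (simp add: diff_divide_distrib algebra_simps)
  next
    case False
    define p where "p = 1 - 2 / \<alpha>"
    define K where "K = - \<alpha> * (\<alpha> + real N - 2)"
    \<comment> \<open>An open set around \<open>s\<close> on which \<open>f_alpha\<close> is a pure
      power. For \<alpha> > 0 it contains \<open>s\<close> because |x| > 1 is strict on the open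
      exterior.\<close>
    define U where "U = (if \<alpha> < 0 then {0<..} else {1<..} :: real set)"
    have s: "s = norm x powr \<alpha>" using False by (simp add: s_def u_alpha_def)
    have "s > 0" using n s by simp
    have "s \<in> U" using n s False by (auto simp: U_def)
    have "(f_alpha N \<alpha> has_real_derivative K * (p * s powr (p - 1))) (at s)"
      by (rule has_field_derivative_transform_within_open[OF
            DERIV_cmult[OF has_real_derivative_powr[OF \<open>s > 0\<close>]] _ \<open>s \<in> U\<close>])
        (use False in \<open>auto simp: U_def f_alpha_def K_def p_def split: if_splits\<close>)
    moreover have "s powr (p - 1) = 1 / (norm x)\<^sup>2"
    proof -
      have "s powr (p - 1) = norm x powr -2"
        using False by (simp add: s powr_powr p_def)
      then show ?thesis using n by (simp add: powr_minus divide_inverse)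
    qed
    moreover have "K * p = - ((\<alpha> - 2) * (\<alpha> + real N - 2))"
      using False by (simp add: K_def p_def field_simps)
    ultimately show ?thesis
      by (simp add: s_def[symmetric] DERIV_imp_deriv mult.assoc[symmetric])
  qed
qed

section \<open>Vanishing integrals of divergences\<close>

lemma lborel_integral_scaleR:
  fixes g :: "'a::euclidean_space \<Rightarrow> real"
  assumes [measurable]: "g \<in> borel_measurable borel" and c: "c > 0"
  shows "(LINT x|lborel. g x) = c ^ DIM('a) * (LINT x|lborel. g (c *\<^sub>R x))"
proof -
  have "(LINT x|lborel. g x) = (LINT x|density (distr lborel borel (\<lambda>x. 0 + c *\<^sub>R x)) (\<lambda>_. ennreal (\<bar>c\<bar> ^ DIM('a))). g x)"
    using lborel_affine[of c "0::'a"] c by (simp add: ennreal_power)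
  also have "\<dots> = (LINT x|distr lborel borel (\<lambda>x::'a. 0 + c *\<^sub>R x). c ^ DIM('a) * g x)"
    using c by (subst integral_density) auto
  also have "\<dots> = (LINT x|lborel. c ^ DIM('a) * g (c *\<^sub>R x))"
    by (subst integral_distr) auto
  finally show ?thesis by simp
qed

text \<open>
  The integral of \<open>x \<mapsto> g (s x)\<close> is \<open>s\<close> to the power \<open>- DIM('a)\<close> times that of \<open>g\<close>; differentiate both
  sides at \<open>s = 1\<close>.
\<close>

lemma euler_identity:
  fixes g :: "'a::euclidean_space \<Rightarrow> real"
  assumes der: "\<And>x. (g has_derivative g' x) (at x)"
    and cont: "continuous_on UNIV (\<lambda>x. g' x x)"
    and supp: "\<And>x. norm x > R \<Longrightarrow> g x = 0"
  shows "integrable lborel (\<lambda>x. g' x x + DIM('a) * g x)"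
    and "(LINT x|lborel. g' x x + DIM('a) * g x) = 0"
proof -
  have gc: "continuous_on UNIV g"
    using der by (intro continuous_at_imp_continuous_on ballI has_derivative_continuous) auto
  have gm [measurable]: "g \<in> borel_measurable borel"
    using gc by (rule borel_measurable_continuous_onI)
  have g'm: "(\<lambda>x. g' x x) \<in> borel_measurable borel"
    using cont by (rule borel_measurable_continuous_onI)
  have int_g: "integrable lborel g"
  proof -
    have "integrable lborel (\<lambda>x. indicator (cball 0 R) x *\<^sub>R g x)"
      by (rule borel_integrable_compact) (auto intro: continuous_on_subset[OF gc])
    moreover have "(\<lambda>x. indicator (cball 0 R) x *\<^sub>R g x) = g"
      using supp by (auto simp: fun_eq_iff indicator_def)
    ultimately show ?thesis by simp
  qed
  \<comment> \<open>Scaling factors decreasing to 1. Being above 1, they shrink the support of g;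
    being at most 2, they keep the intermediate points of the mean value theorem in the ball of
    radius 2R.\<close>
  define t where "t n = 1 + 1 / real (Suc n)" for n
  have t: "1 < t n" "t n \<le> 2" for n
    by (auto simp: t_def)
  define q where "q n x = (g (t n *\<^sub>R x) - g x) / (t n - 1)" for n x
  have "compact ((\<lambda>x. g' x x) ` cball 0 (2 * R))"
    by (rule compact_continuous_image) (auto intro: continuous_on_subset[OF cont])
  then obtain M where M: "\<And>x. norm x \<le> 2 * R \<Longrightarrow> \<bar>g' x x\<bar> \<le> M"
    by (force simp: bounded_iff dest!: compact_imp_bounded)
  have ray: "((\<lambda>s. g (s *\<^sub>R x)) has_real_derivative g' (s *\<^sub>R x) x) (at s)" for s x
  proof -
    interpret linear "g' (s *\<^sub>R x)"
      using der has_derivative_linear by blast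
    have "((\<lambda>s. g (s *\<^sub>R x)) has_derivative (\<lambda>h. g' (s *\<^sub>R x) (h *\<^sub>R x))) (at s)"
      by (rule has_derivative_compose[OF _ der]) (auto intro!: derivative_eq_intros)
    then show ?thesis
      by (simp add: has_field_derivative_def scale mult.commute[of _ "g' _ _"] )
  qed
  \<comment> \<open>The mean value theorem along the ray through \<open>x\<close> bounds the
    difference quotients uniformly in \<open>n\<close>, which provides the dominating function for
    their limit.\<close>
  have bound: "\<bar>q n x\<bar> \<le> indicator (cball 0 R) x * M" for n x
  proof (cases "norm x \<le> R")
    case True
    obtain z where z: "1 < z" "z < t n" "g (t n *\<^sub>R x) - g (1 *\<^sub>R x) = (t n - 1) * g' (z *\<^sub>R x) x"
      using MVT2[OF t(1)[of n], of "\<lambda>s. g (s *\<^sub>R x)" "\<lambda>s. g' (s *\<^sub>R x) x"] ray by blast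
    interpret linear "g' (z *\<^sub>R x)"
      using der has_derivative_linear by blast
    have "q n x = g' (z *\<^sub>R x) x"
      using z t(1)[of n] by (simp add: q_def)
    \<comment> \<open>\<open>M\<close> bounds the derivative at a point in the direction of that
      same point, so the direction is rescaled to \<open>z *\<^sub>R x\<close>; the factor 1/z is
      less than 1.\<close>
    also have "\<dots> = g' (z *\<^sub>R x) (z *\<^sub>R x) / z"
      using z by (simp add: scale)
    finally have "\<bar>q n x\<bar> \<le> \<bar>g' (z *\<^sub>R x) (z *\<^sub>R x)\<bar>"
      using z by (simp add: divide_le_eq mult_le_cancel_left1)
    also have "\<dots> \<le> M"
    proof (rule M)
      have "z * norm x \<le> 2 * R"
        using z t(2)[of n] True by (intro mult_mono) auto
      then show "norm (z *\<^sub>R x) \<le> 2 * R" using z by simp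
    qed
    finally show ?thesis using True by simp
  next
    case False
    have "norm (t n *\<^sub>R x) \<ge> norm x"
      using t(1)[of n] by (simp add: mult_le_cancel_right1)
    then show ?thesis
      using False supp[of x] supp[of "t n *\<^sub>R x"] by (simp add: q_def)
  qed
  have t_lim: "(\<lambda>n. t n - 1) \<longlonglongrightarrow> 0"
    unfolding t_def using LIMSEQ_inverse_real_of_nat by (simp add: inverse_eq_divide)
  have slope: "(\<lambda>n. (h (t n) - h 1) / (t n - 1)) \<longlonglongrightarrow> d" if "(h has_real_derivative d) (at 1)" for h d
  proof -
    have "((\<lambda>e. (h (1 + e) - h 1) / e) \<longlongrightarrow> d) (at 0)"
      using that by (simp add: DERIV_def)
    moreover have "filterlim (\<lambda>n. t n - 1) (at 0) sequentially"
      using t_lim t(1) by (auto simp: filterlim_at intro!: always_eventually simp: less_imp_neq[symmetric])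
    ultimately have "(\<lambda>n. (h (1 + (t n - 1)) - h 1) / (t n - 1)) \<longlonglongrightarrow> d"
      by (rule filterlim_compose)
    then show ?thesis by simp
  qed
  have lim: "(\<lambda>n. q n x) \<longlonglongrightarrow> g' x x" for x
    using slope[OF ray[of x 1, simplified scaleR_one]] by (simp add: q_def)
  have w: "integrable lborel (\<lambda>x::'a. indicator (cball 0 R) x * M)"
    by (intro integrable_mult_left integrable_real_indicator) (use emeasure_bounded_finite[OF bounded_cball, of "0::'a" R] in auto)
  have qm: "q n \<in> borel_measurable lborel" for n
    unfolding q_def by measurable
  have int_g': "integrable lborel (\<lambda>x. g' x x)"
    by (rule integrable_dominated_convergence[where s = q, OF _ qm w])
      (use g'm lim bound in auto)
  have "(\<lambda>n. LINT x|lborel. q n x) \<longlonglongrightarrow> (LINT x|lborel. g' x x)"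
    by (rule integral_dominated_convergence[where s = q, OF _ qm w])
      (use g'm lim bound in auto)
  \<comment> \<open>By scaling, the integral of \<open>q n\<close> is itself a difference quotient
    at 1 of a negative power of s.\<close>
  moreover have "(LINT x|lborel. q n x) = ((inverse (t n) ^ DIM('a) * integral\<^sup>L lborel g) - (inverse 1 ^ DIM('a) * integral\<^sup>L lborel g)) / (t n - 1)" for n
  proof -
    have "integrable lborel (\<lambda>x. g (t n *\<^sub>R x))"
    proof -
      have "integrable lborel (\<lambda>x. (t n - 1) * q n x + g x)"
        by (intro Bochner_Integration.integrable_add integrable_mult_right int_g
            Bochner_Integration.integrable_bound[OF w qm]) (use bound in \<open>auto intro: order_trans[OF _ abs_ge_self]\<close>)
      then show ?thesis using t(1)[of n] by (simp add: q_def)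
    qed
    then have "(LINT x|lborel. q n x) = ((LINT x|lborel. g (t n *\<^sub>R x)) - integral\<^sup>L lborel g) / (t n - 1)"
      unfolding q_def using int_g by simp
    moreover have "(LINT x|lborel. g (t n *\<^sub>R x)) = inverse (t n) ^ DIM('a) * integral\<^sup>L lborel g"
      using lborel_integral_scaleR[OF gm, of "t n"] t(1)[of n] by (simp add: field_simps)
    ultimately show ?thesis by simp
  qed
  moreover have "((\<lambda>s. inverse s ^ DIM('a) * integral\<^sup>L lborel g) has_real_derivative - DIM('a) * integral\<^sup>L lborel g) (at 1)"
    by (auto intro!: derivative_eq_intros)
  from slope[OF this] have "(\<lambda>n. ((inverse (t n) ^ DIM('a) * integral\<^sup>L lborel g) - (inverse 1 ^ DIM('a) * integral\<^sup>L lborel g)) / (t n - 1)) \<longlonglongrightarrow> - DIM('a) * integral\<^sup>L lborel g" .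
  ultimately have "(LINT x|lborel. g' x x) = - DIM('a) * integral\<^sup>L lborel g"
    by (simp add: LIMSEQ_unique)
  then show "integrable lborel (\<lambda>x. g' x x + DIM('a) * g x)"
    and "(LINT x|lborel. g' x x + DIM('a) * g x) = 0"
    using int_g int_g' by simp_all
qed

text \<open>The open sets \<open>S\<close> and \<open>- K\<close> cover the space and
  \<open>g\<close> vanishes on their intersection, so its extension by zero is differentiable
  everywhere and \<open>euler_identity\<close> applies to it.\<close>

lemma euler_identity_on:
  fixes g :: "'a::euclidean_space \<Rightarrow> real"
  assumes S: "open S" and K: "compact K" "K \<subseteq> S"
    and der: "\<And>x. x \<in> S \<Longrightarrow> (g has_derivative g' x) (at x)"
    and cont: "continuous_on S (\<lambda>x. g' x x)"
    and supp: "\<And>x. x \<in> S - K \<Longrightarrow> g x = 0"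
  shows "set_integrable lborel S (\<lambda>x. g' x x + DIM('a) * g x)"
    and "(LINT x:S|lborel. g' x x + DIM('a) * g x) = 0"
proof -
  define h where "h x = (if x \<in> S then g x else 0)" for x
  define h' where "h' x = (if x \<in> S then g' x else (\<lambda>_. 0))" for x
  have oK: "open (- K)"
    using K(1) compact_imp_closed by auto
  have "(h has_derivative (\<lambda>_. 0)) (at x)" if "x \<notin> K" for x
    by (rule has_derivative_transform_within_open[of "\<lambda>_. 0" _ _ _ "- K"])
      (use that oK supp in \<open>auto simp: h_def\<close>)
  moreover have inS: "(h has_derivative g' x) (at x)" if "x \<in> S" for x
    by (rule has_derivative_transform_within_open[OF der S])
      (use that in \<open>auto simp: h_def\<close>)
  ultimately have h': "(h has_derivative h' x) (at x)" for x
    using K(2) by (auto simp: h'_def)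
  \<comment> \<open>On \<open>- K\<close> the extension is locally zero, so uniqueness of the
    derivative makes \<open>h'\<close> vanish there; continuity is then glued over the open
    cover.\<close>
  have "h' x x = 0" if "x \<in> - K" for x
  proof -
    have "(h has_derivative (\<lambda>_. 0)) (at x)"
      by (rule has_derivative_transform_within_open[of "\<lambda>_. 0" _ _ _ "- K"])
        (use that oK supp in \<open>auto simp: h_def\<close>)
    from has_derivative_unique[OF this h'] show ?thesis by metis
  qed
  then have "continuous_on (- K) (\<lambda>x. h' x x)"
    using continuous_on_cong[of "- K" "- K" "\<lambda>_. 0" "\<lambda>x. h' x x"] by auto
  moreover have "continuous_on S (\<lambda>x. h' x x)"
    using cont by (rule continuous_on_eq) (auto simp: h'_def)
  ultimately have "continuous_on (- K \<union> S) (\<lambda>x. h' x x)"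
    using oK S by (intro continuous_on_open_Un)
  then have c: "continuous_on UNIV (\<lambda>x. h' x x)"
    by (rule continuous_on_subset) (use K(2) in auto)
  obtain R where R: "\<And>x. x \<in> K \<Longrightarrow> norm x \<le> R"
    using compact_imp_bounded[OF K(1)] by (auto simp: bounded_iff)
  have z: "h x = 0" if "norm x > R" for x
    using R[of x] that supp by (auto simp: h_def)
  have eq: "indicator S x *\<^sub>R (g' x x + DIM('a) * g x) = h' x x + DIM('a) * h x" for x
    by (simp add: h_def h'_def)
  show "set_integrable lborel S (\<lambda>x. g' x x + DIM('a) * g x)"
    and "(LINT x:S|lborel. g' x x + DIM('a) * g x) = 0"
    unfolding set_integrable_def set_lebesgue_integral_def eq
    by (rule euler_identity[OF h' c]; use z in auto)+
qed

section \<open>Hardy's inequality for test functions\<close>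

text \<open>With m = (DIM('a) - 2) / 2, the integrand plus m div (g x) is a square plus (c + m^2)
  v^2 / |x|^2, hence nonnegative, while the divergence integrates to 0.\<close>

lemma test_function_nonneg:
  fixes v :: "'a::euclidean_space \<Rightarrow> real"
  assumes v: "test_function v" and c: "0 \<le> c + ((real DIM('a) - 2) / 2)\<^sup>2"
  shows "0 \<le> (LINT x:open_exterior|lborel.
           (norm (gradient_within v open_exterior x))\<^sup>2 + c / (norm x)\<^sup>2 * (v x)\<^sup>2)"
proof -
  define S where "S = (open_exterior :: 'a set)"
  define K where "K = closure (support_on S v)"
  define G where "G = gradient_within v S"
  define m where "m = (real DIM('a) - 2) / 2"
  define Q where "Q = (\<lambda>x. (norm (G x))\<^sup>2 + c / (norm x)\<^sup>2 * (v x)\<^sup>2)"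
  define g where "g = (\<lambda>x. (v x)\<^sup>2 / (x \<bullet> x))"
  define g' where "g' = (\<lambda>x h. 2 * v x * (G x \<bullet> h) / (x \<bullet> x) - (v x)\<^sup>2 * (2 * (x \<bullet> h)) / (x \<bullet> x)\<^sup>2)"
  have S: "open S" by (simp add: S_def open_open_exterior)
  have K: "compact K" "K \<subseteq> S"
    using v unfolding test_function_def K_def S_def by blast+
  have nz: "x \<noteq> 0" if "x \<in> S" for x
    using that by (auto simp: S_def open_exterior_def)
  have C1: "v differentiable_on S" "continuous_on S G"
    using v unfolding test_function_def C1_on_def S_def G_def by blast+
  have v': "(v has_derivative (\<lambda>h. G x \<bullet> h)) (at x)" if "x \<in> S" for x
  proof -
    have "v differentiable (at x within S)"
      using C1(1) that by (simp add: differentiable_on_def)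
    from has_derivative_gradient_within[OF this] show ?thesis
      unfolding G_def at_within_open[OF that S] .
  qed
  have g': "(g has_derivative g' x) (at x)" if "x \<in> S" for x
    unfolding g_def g'_def
    by (rule has_derivative_eq_rhs[OF has_derivative_divide'[OF has_derivative_power[OF v'[OF that]]
            has_derivative_inner[OF has_derivative_ident has_derivative_ident]]])
      (use nz[OF that] in \<open>simp_all add: fun_eq_iff field_simps inner_commute power2_eq_square\<close>)
  have cont: "continuous_on S (\<lambda>x. g' x x)"
    unfolding g'_def using C1(2) differentiable_imp_continuous_on[OF C1(1)] nz
    by (intro continuous_intros) auto
  have supp: "g x = 0" if "x \<in> S - K" for x
    using that closure_subset[of "support_on S v"] by (auto simp: g_def K_def support_on_def)
  note euler = euler_identity_on[OF S K g' cont supp]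
  have pointwise: "- m * (g' x x + DIM('a) * g x) \<le> Q x" if "x \<in> S" for x
  proof -
    define r where "r = norm x"
    have r: "r > 0" "x \<bullet> x = r\<^sup>2"
      using nz[OF that] by (auto simp: r_def power2_norm_eq_inner)
    have "DIM('a) = 2 * m + 2" by (simp add: m_def field_simps)
    have e: "g' x x + DIM('a) * g x = 2 * (v x * (G x \<bullet> x)) / r\<^sup>2 + 2 * m * ((v x)\<^sup>2 / r\<^sup>2)"
      unfolding g'_def g_def r(2) \<open>DIM('a) = 2 * m + 2\<close> using r(1)
      by (simp add: field_simps power2_eq_square)
    \<comment> \<open>The vector inside the norm vanishes for v = |x|^(-m), the virtual extremal of
      Hardy's inequality.\<close>
    have "0 \<le> (norm (G x + (m * v x / r\<^sup>2) *\<^sub>R x))\<^sup>2"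
      by simp
    also have "\<dots> = (norm (G x))\<^sup>2 + 2 * (m * v x / r\<^sup>2) * (G x \<bullet> x) + (m * v x / r\<^sup>2)\<^sup>2 * r\<^sup>2"
      unfolding power2_norm_eq_inner r(2)[symmetric]
      by (simp add: inner_add inner_commute algebra_simps power2_eq_square)
    also have "\<dots> = (norm (G x))\<^sup>2 + m * (2 * (v x * (G x \<bullet> x)) / r\<^sup>2) + m\<^sup>2 * ((v x)\<^sup>2 / r\<^sup>2)"
      using r(1) by (simp add: field_simps power2_eq_square)
    finally have 1: "0 \<le> \<dots>" .
    have 2: "0 \<le> (c + m\<^sup>2) * ((v x)\<^sup>2 / r\<^sup>2)"
      using c by (simp add: m_def)
    have "Q x + m * (g' x x + DIM('a) * g x) =
        ((norm (G x))\<^sup>2 + m * (2 * (v x * (G x \<bullet> x)) / r\<^sup>2) + m\<^sup>2 * ((v x)\<^sup>2 / r\<^sup>2)) + (c + m\<^sup>2) * ((v x)\<^sup>2 / r\<^sup>2)"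
      unfolding e Q_def r_def[symmetric] by (simp add: algebra_simps add_divide_distrib power2_eq_square)
    then show ?thesis using 1 2 by linarith
  qed
  have "0 \<le> (LINT x:S|lborel. Q x)"
  proof (cases "set_integrable lborel S Q")
    case True
    have "(LINT x:S|lborel. - m * (g' x x + DIM('a) * g x)) \<le> (LINT x:S|lborel. Q x)"
      by (rule set_integral_mono[OF set_integrable_mult_right[OF euler(1)] True]) (use pointwise in auto)
    moreover have "(LINT x:S|lborel. - m * (g' x x + DIM('a) * g x)) = 0"
      using euler(2) by (subst set_integral_mult_right) simp
    ultimately show ?thesis by linarith
  next
    \<comment> \<open>The integral of a non-integrable function is 0 by convention, so the
      inequality holds here too.\<close>
    case False
    then show ?thesis
      by (simp add: set_integrable_def set_lebesgue_integral_def not_integrable_integral_eq)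
  qed
  then show ?thesis
    by (simp add: Q_def S_def G_def)
qed

section \<open>The cut-off profile\<close>

lemma DERIV_max_0_power:
  fixes z :: real
  assumes "n \<ge> 2"
  shows "((\<lambda>z. max 0 z ^ n) has_real_derivative real n * max 0 z ^ (n - 1)) (at z)"
proof -
  \<comment> \<open>The exponent 0 is excluded because \<open>max 0 s ^ 0\<close> is 1.\<close>
  have "(if s > 0 then s powr real k else 0) = max 0 s ^ k" if "k > 0" for s :: real and k
    using that by (auto simp: powr_realpow max_def)
  note eq = this
  have "(\<lambda>s. if s > 0 then s powr real n else 0) = (\<lambda>s. max 0 s ^ n)"
    using eq[of n] assms by auto
  moreover have "(if z > 0 then real n * z powr (real n - 1) else 0) = real n * max 0 z ^ (n - 1)"
    using eq[of "n - 1" z] assms by (auto simp: of_nat_diff)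
  ultimately show ?thesis
    using DERIV_pos_part_powr[of "real n" z] assms by simp
qed

text \<open>The profile itself has corners at -1 and 1; its powers from the second on are
  continuously differentiable, and on [-1, 1] they are polynomials.\<close>

definition bump :: "real \<Rightarrow> real" where
  "bump t = max 0 (1 - t\<^sup>2)"

lemma DERIV_bump_power:
  assumes "n \<ge> 2"
  shows "((\<lambda>t. bump t ^ n) has_real_derivative - 2 * real n * t * bump t ^ (n - 1)) (at t)"
proof -
  have "((\<lambda>t. 1 - t\<^sup>2) has_real_derivative - 2 * t) (at t)"
    by (auto intro!: derivative_eq_intros)
  from DERIV_chain2[OF DERIV_max_0_power[OF assms] this] show ?thesis
    by (simp add: bump_def mult_ac)
qed

lemma continuous_on_bump [continuous_intros]:
  "continuous_on S f \<Longrightarrow> continuous_on S (\<lambda>x. bump (f x))"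
  unfolding bump_def by (intro continuous_intros)

text \<open>
  The derivative of \<open>bump\<^sup>2\<close> has square \<open>16 t\<^sup>2 bump\<^sup>2\<close>, which therefore has the same integral as
  \<open>3 bump\<^sup>4\<close>.
\<close>

lemma DERIV_bump_primitive:
  "((\<lambda>t. bump t ^ 3 * (t ^ 3 / 3 - 3 * t)) has_real_derivative
     16 * t\<^sup>2 * bump t ^ 2 - 3 * bump t ^ 4) (at t)"
proof -
  have "- 6 * t * bump t ^ 2 * (t ^ 3 / 3 - 3 * t) + bump t ^ 3 * (t\<^sup>2 - 3) =
      16 * t\<^sup>2 * bump t ^ 2 - 3 * bump t ^ 4"
  \<comment> \<open>Both sides vanish where \<open>bump t\<close> does; elsewhere the claim is a
    polynomial identity.\<close>
  proof (cases "bump t = 0")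
    case False
    then have b: "bump t = 1 - t\<^sup>2"
      by (auto simp: bump_def max_def split: if_splits)
    show ?thesis
      unfolding b by algebra
  qed simp
  moreover have "((\<lambda>t. bump t ^ 3 * (t ^ 3 / 3 - 3 * t)) has_real_derivative
      - 6 * t * bump t ^ 2 * (t ^ 3 / 3 - 3 * t) + bump t ^ 3 * (t\<^sup>2 - 3)) (at t)"
  proof (rule DERIV_cong[OF DERIV_mult[OF DERIV_bump_power]])
    show "((\<lambda>t. t ^ 3 / 3 - 3 * t) has_real_derivative t\<^sup>2 - 3) (at t)"
      by (auto intro!: derivative_eq_intros)
  qed simp_all
  ultimately show ?thesis by simp
qed

section \<open>A test function with negative energy\<close>

text \<open>The virtual extremal |x|^(-m) is cut off slowly on the logarithmic scale. The cut-off
  costs only 3 \<epsilon>^2 in the constant, which a strictly negative c + m^2 can pay for.\<close>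

lemma ex_test_function_neg:
  assumes c: "c + ((real DIM('a) - 2) / 2)\<^sup>2 < 0"
  shows "\<exists>v :: 'a::euclidean_space \<Rightarrow> real. test_function v \<and>
     (LINT x:open_exterior|lborel.
        (norm (gradient_within v open_exterior x))\<^sup>2 + c / (norm x)\<^sup>2 * (v x)\<^sup>2) < 0"
proof -
  define S where "S = (open_exterior :: 'a set)"
  define m where "m = (real DIM('a) - 2) / 2"
  define N where "N = real DIM('a)"
  \<comment> \<open>With this choice \<open>\<kappa>\<close> equals (c + m^2) / 2.\<close>
  define \<epsilon> where "\<epsilon> = sqrt (- (c + m\<^sup>2) / 6)"
  define \<kappa> where "\<kappa> = 3 * \<epsilon>\<^sup>2 + m\<^sup>2 + c"
  have N: "N = 2 * m + 2" by (simp add: N_def m_def field_simps)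
  have "\<epsilon> > 0" "\<epsilon>\<^sup>2 = - (c + m\<^sup>2) / 6"
    using c by (auto simp: \<epsilon>_def m_def)
  then have "\<kappa> < 0"
    using c by (simp add: \<kappa>_def m_def)
  \<comment> \<open>The shift by 2 turns |t| \<le> 1 into 1 \<le> \<epsilon> ln r \<le> 3, which
    keeps the support away from the unit sphere.\<close>
  define t where "t r = \<epsilon> * ln r - 2" for r
  define \<phi> where "\<phi> r = r powr - m * bump (t r) ^ 2" for r
  define \<phi>' where "\<phi>' r = - (r powr (- m - 1) * (m * bump (t r) ^ 2 + 4 * \<epsilon> * t r * bump (t r)))" for r
  \<comment> \<open>The squared gradient of \<open>v\<close> contains 16 \<epsilon>^2 s^2 b^2 and
    the cross term 8 m \<epsilon> s b^3, where b = \<open>bump s\<close>. The first summand of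
    \<open>\<Gamma>\<close> trades the former for 3 \<epsilon>^2 b^4; the second absorbs the
    latter.\<close>
  define \<Gamma> where "\<Gamma> s = \<epsilon> * (bump s ^ 3 * (s ^ 3 / 3 - 3 * s)) - m * bump s ^ 4" for s
  define \<Gamma>' where "\<Gamma>' s = \<epsilon> * (16 * s\<^sup>2 * bump s ^ 2 - 3 * bump s ^ 4) + 8 * m * s * bump s ^ 3" for s
  \<comment> \<open>The weight r^(-N) cancels the zeroth-order term: r \<gamma>' + N \<gamma> =
    \<epsilon> r^(-N) \<Gamma>'(t r).\<close>
  define \<gamma> where "\<gamma> r = r powr - N * \<Gamma> (t r)" for r
  define \<gamma>' where "\<gamma>' r = r powr (- N - 1) * (\<epsilon> * \<Gamma>' (t r) - N * \<Gamma> (t r))" for r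
  define v where "v x = \<phi> (norm x)" for x :: 'a
  define G where "G x = (\<phi>' (norm x) / norm x) *\<^sub>R x" for x :: 'a
  define g where "g x = \<gamma> (norm x)" for x :: 'a
  define g' where "g' x h = (\<gamma>' (norm x) / norm x) *\<^sub>R x \<bullet> h" for x h :: 'a
  define H where "H x = norm x powr - N * bump (t (norm x)) ^ 4" for x :: 'a
  \<comment> \<open>\<open>K\<close> is a closed shell outside which the cut-off vanishes;
    \<open>A\<close> is an open shell on which it is positive.\<close>
  define K where "K = cball 0 (exp (3 / \<epsilon>)) - ball (0::'a) (exp (1 / \<epsilon>))"
  define A where "A = ball 0 (exp (3 / \<epsilon>)) - cball (0::'a) (exp (1 / \<epsilon>))"
  have S: "open S" by (simp add: S_def open_open_exterior)
  have nz: "norm x > 0" "x \<noteq> 0" if "x \<in> S" for x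
    using that by (auto simp: S_def open_exterior_def)
  have "1 < exp (1 / \<epsilon>)" using \<open>\<epsilon> > 0\<close> by simp
  then have "K \<subseteq> S"
    unfolding K_def S_def open_exterior_def by (meson ComplI DiffD2 dual_order.strict_trans2 mem_ball_0 mem_cball_0 not_less subsetI)
  then have K: "compact K" "K \<subseteq> S"
    by (auto simp: K_def intro!: compact_diff)
  have exp_le: "exp (a / \<epsilon>) \<le> r \<longleftrightarrow> a \<le> \<epsilon> * ln r" if "r > 0" for a r
    using that \<open>\<epsilon> > 0\<close> by (simp add: ln_ge_iff[symmetric] field_simps)
  have exp_less: "exp (a / \<epsilon>) < r \<longleftrightarrow> a < \<epsilon> * ln r" if "r > 0" for a r
    using that \<open>\<epsilon> > 0\<close> by (subst ln_less_cancel_iff[symmetric]) (auto simp: field_simps)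
  have bump0: "bump (t (norm x)) = 0" if "x \<in> S - K" for x
  proof -
    have "t (norm x) < - 1 \<or> 1 < t (norm x)"
      using that nz[of x] exp_le[of "norm x" 1] exp_less[of "norm x" 3]
      by (auto simp: K_def t_def not_le)
    then have "1 < (t (norm x))\<^sup>2"
      by (auto simp: abs_square_less_1 power2_eq_square not_le[symmetric] abs_square_le_1[unfolded power2_eq_square])
    then show ?thesis by (simp add: bump_def)
  qed
  have bump_pos: "bump (t (norm x)) > 0" "x \<in> S" if "x \<in> A" for x
  proof -
    have "1 < norm x"
      using that by (intro less_trans[OF \<open>1 < exp (1 / \<epsilon>)\<close>]) (auto simp: A_def)
    then show "x \<in> S"
      by (simp add: S_def open_exterior_def)
    have "\<bar>t (norm x)\<bar> < 1"
      using that nz[OF \<open>x \<in> S\<close>] exp_less[of "norm x" 1] exp_le[of "norm x" 3]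
      by (auto simp: A_def t_def not_le abs_less_iff)
    then have "(t (norm x))\<^sup>2 < 1"
      by (simp add: abs_square_less_1)
    then show "bump (t (norm x)) > 0" by (simp add: bump_def)
  qed
  have t': "(t has_real_derivative \<epsilon> / r) (at r)" if "r > 0" for r
    unfolding t_def using that by (auto intro!: derivative_eq_intros)
  have powr': "((\<lambda>r. r powr - a) has_real_derivative - a * r powr (- a - 1)) (at r)" if "r > 0" for a r :: real
    by (rule has_real_derivative_powr[OF that])
  have powr_r: "r powr - a = r powr (- a - 1) * r" if "r > 0" for a r :: real
    using that powr_add[of r "-a-1" 1] by simp
  have \<phi>': "(\<phi> has_real_derivative \<phi>' r) (at r)" if "r > 0" for r
  proof -
    have "((\<lambda>r. bump (t r) ^ 2) has_real_derivative - 4 * t r * bump (t r) * (\<epsilon> / r)) (at r)"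
      using DERIV_chain2[OF DERIV_bump_power[of 2] t'[OF that]] by simp
    from DERIV_mult[OF powr'[OF that] this] show ?thesis
      unfolding \<phi>_def \<phi>'_def
      by (rule DERIV_cong) (use that in \<open>simp add: powr_r[OF that, of m] field_simps\<close>)
  qed
  have \<Gamma>': "(\<Gamma> has_real_derivative \<Gamma>' s) (at s)" for s
    unfolding \<Gamma>_def \<Gamma>'_def
    using DERIV_diff[OF DERIV_cmult[OF DERIV_bump_primitive, of \<epsilon> s] DERIV_cmult[OF DERIV_bump_power[of 4 s], of m]]
    by (simp add: mult_ac)
  have \<gamma>': "(\<gamma> has_real_derivative \<gamma>' r) (at r)" if "r > 0" for r
    using DERIV_mult[OF powr'[OF that] DERIV_chain2[OF \<Gamma>' t'[OF that]], of N]
    unfolding \<gamma>_def \<gamma>'_def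
    by (rule DERIV_cong) (use that in \<open>simp add: powr_r[OF that, of N] field_simps\<close>)
  have v': "(v has_derivative (\<lambda>h. G x \<bullet> h)) (at x within S)" if "x \<in> S" for x
    unfolding v_def G_def by (rule has_derivative_radial) (use nz[OF that] \<phi>' in auto)
  have grad: "gradient_within v S x = G x" if "x \<in> S" for x
    using gradient_within_eqI[OF v'[OF that] segment_in_open[OF S that]] by blast
  have g': "(g has_derivative g' x) (at x)" if "x \<in> S" for x
    unfolding g_def g'_def by (rule has_derivative_radial) (use nz[OF that] \<gamma>' in auto)
  have cont_G: "continuous_on S G"
    unfolding G_def \<phi>'_def t_def using nz by (intro continuous_intros) auto
  have cont_g': "continuous_on S (\<lambda>x. g' x x)"
    unfolding g'_def \<gamma>'_def \<Gamma>_def \<Gamma>'_def t_def using nz by (intro continuous_intros) auto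
  have cont_H: "continuous_on S H"
    unfolding H_def t_def using nz by (intro continuous_intros) auto
  have supp: "g x = 0" if "x \<in> S - K" for x
    using bump0[OF that] by (simp add: g_def \<gamma>_def \<Gamma>_def)
  have N_eq: "DIM('a) = N" by (simp add: N_def)
  note euler = euler_identity_on[OF S K g' cont_g' supp, unfolded N_eq]
  have "test_function v"
  proof -
    have sub: "closure (support_on S v) \<subseteq> K"
      using K(1) bump0 by (intro closure_minimal compact_imp_closed)
        (auto simp: support_on_def v_def \<phi>_def)
    have "C1_on v S"
      using v' cont_G unfolding C1_on_def differentiable_on_def differentiable_def
      by (auto cong: continuous_on_cong simp: grad)
    then show ?thesis
      using sub K compact_Int_closed[OF K(1), of "closure (support_on S v)"]
      by (auto simp: test_function_def S_def[symmetric] Int_absorb1)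
  qed
  moreover have "(LINT x:S|lborel. (norm (gradient_within v S x))\<^sup>2 + c / (norm x)\<^sup>2 * (v x)\<^sup>2) < 0"
  proof -
    \<comment> \<open>The integrand is \<open>\<kappa> * H x\<close> plus the divergence of g(x) x,
      so only the sign of \<open>\<kappa>\<close> matters once \<open>H\<close> has positive
      integral.\<close>
    have eq: "(norm (gradient_within v S x))\<^sup>2 + c / (norm x)\<^sup>2 * (v x)\<^sup>2 =
        \<kappa> * H x + (g' x x + N * g x)" if "x \<in> S" for x
    proof -
      define r where "r = norm x"
      define s where "s = t r"
      define P where "P = r powr (- m - 1)"
      have r: "r > 0" using nz[OF that] by (simp add: r_def)
      \<comment> \<open>Because N = 2m + 2, all powers of r become multiples of powers of
        \<open>P\<close>, which leaves a polynomial identity.\<close>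
      have P: "r powr - m = P * r" "r powr - N = P\<^sup>2" "r powr (- N - 1) * r = P\<^sup>2"
        using powr_r[OF r, of m] powr_r[OF r, of N] powr_add[of r "-m-1" "-m-1"]
        by (simp_all add: P_def N power2_eq_square)
      have "(norm (G x))\<^sup>2 = (P * (m * bump s ^ 2 + 4 * \<epsilon> * s * bump s))\<^sup>2"
        using r by (simp add: G_def r_def[symmetric] \<phi>'_def P_def s_def abs_mult power_mult_distrib)
      moreover have "c / r\<^sup>2 * (v x)\<^sup>2 = c * (P * bump s ^ 2)\<^sup>2"
        using r by (simp add: v_def \<phi>_def r_def[symmetric] P s_def power_mult_distrib)
      moreover have "g' x x + N * g x = P\<^sup>2 * \<epsilon> * \<Gamma>' s"
      proof -
        have "g' x x = \<gamma>' r * r"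
          using r by (simp add: g'_def r_def[symmetric] power2_norm_eq_inner[symmetric] power2_eq_square)
        also have "\<dots> = P\<^sup>2 * (\<epsilon> * \<Gamma>' s - N * \<Gamma> s)"
          using P(3) by (simp add: \<gamma>'_def s_def)
        finally show ?thesis
          by (simp add: g_def r_def[symmetric] \<gamma>_def P s_def algebra_simps)
      qed
      moreover have "H x = P\<^sup>2 * bump s ^ 4"
        by (simp add: H_def r_def[symmetric] s_def P)
      moreover have "(P * (m * bump s ^ 2 + 4 * \<epsilon> * s * bump s))\<^sup>2 + c * (P * bump s ^ 2)\<^sup>2 =
          \<kappa> * (P\<^sup>2 * bump s ^ 4) + P\<^sup>2 * \<epsilon> * \<Gamma>' s"
        unfolding \<kappa>_def \<Gamma>'_def by algebra
      ultimately show ?thesis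
        by (simp add: grad[OF that] r_def[symmetric])
    qed
    have "(\<lambda>x. indicator S x *\<^sub>R H x) = (\<lambda>x. indicator K x *\<^sub>R H x)"
      using bump0 K(2) by (auto simp: fun_eq_iff H_def indicator_def)
    then have int_H: "set_integrable lborel S H"
      using borel_integrable_compact[OF K(1) continuous_on_subset[OF cont_H K(2)]]
      by (simp add: set_integrable_def)
    have "0 \<le> (LINT x:S|lborel. H x)"
      unfolding set_lebesgue_integral_def by (rule Bochner_Integration.integral_nonneg) (simp add: H_def)
    \<comment> \<open>Were the integral zero, the nonempty open shell \<open>A\<close>, where
      \<open>H\<close> is positive, would be a null set.\<close>
    moreover have "(LINT x:S|lborel. H x) \<noteq> 0"
    proof
      assume "(LINT x:S|lborel. H x) = 0"
      then have "AE x in lborel. indicator S x *\<^sub>R H x = 0"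
        using integral_nonneg_eq_0_iff_AE[OF int_H[unfolded set_integrable_def]]
        by (simp add: set_lebesgue_integral_def H_def)
      moreover have "x \<notin> A" if "indicator S x *\<^sub>R H x = 0" for x
        using that bump_pos[of x] nz[of x] by (auto simp: H_def)
      ultimately have "AE x in lborel. x \<notin> A"
        by (auto elim: eventually_mono)
      moreover have "A \<in> sets lborel"
        by (simp add: A_def)
      ultimately have "A \<in> null_sets lborel"
        by (simp add: AE_iff_null_sets)
      then have "negligible A"
        by (simp add: negligible_iff_null_sets null_sets_completionI)
      moreover have "open A"
        by (simp add: A_def open_Diff)
      moreover have "A \<noteq> {}"
      proof -
        obtain b :: 'a where "b \<in> Basis" using nonempty_Basis by blast
        \<comment> \<open>This radius is the centre of the shell on the logarithmic scale, where t =
          0.\<close>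
        then have "exp (2 / \<epsilon>) *\<^sub>R b \<in> A"
          using \<open>\<epsilon> > 0\<close> by (simp add: A_def not_le divide_strict_right_mono)
        then show ?thesis by blast
      qed
      ultimately show False using open_not_negligible by blast
    qed
    ultimately have "\<kappa> * (LINT x:S|lborel. H x) < 0"
      using \<open>\<kappa> < 0\<close> by (simp add: mult_neg_pos)
    moreover have "(LINT x:S|lborel. (norm (gradient_within v S x))\<^sup>2 + c / (norm x)\<^sup>2 * (v x)\<^sup>2) =
        (LINT x:S|lborel. \<kappa> * H x + (g' x x + N * g x))"
      using S eq by (intro set_lebesgue_integral_cong) auto
    moreover have "\<dots> = \<kappa> * (LINT x:S|lborel. H x)"
      using int_H euler by (subst set_integral_add) auto
    ultimately show ?thesis by simp
  qed
  ultimately show ?thesis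
    by (auto simp: S_def)
qed

section \<open>From the Hardy constant to the range of \<alpha>\<close>

theorem mainTheorem5:
  fixes \<alpha> :: real and u :: "real ^ 'n \<Rightarrow> real" and N :: nat and f :: "real \<Rightarrow> real"
  assumes "N = CARD('n)" and "N \<ge> 2"
    and "u = u_alpha \<alpha>" and "f = f_alpha N \<alpha>"
  shows "f C1_differentiable_on UNIV \<and> exterior_solution f u \<and>
    (stable_solution f u \<longleftrightarrow>
       \<alpha> \<ge> - real N / 2 + sqrt (real N - 1) + 2 \<or>
       \<alpha> \<le> - real N / 2 - sqrt (real N - 1) + 2)"
proof -
  define c where "c = (\<alpha> - 2) * (\<alpha> + real N - 2)"
  have N: "DIM(real ^ 'n) = N" using assms(1) by simp
  have sol: "exterior_solution f u"
    using exterior_solution_u_alpha[where 'a = "real ^ 'n" and \<alpha> = \<alpha>] assms N by simp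
  have "(LINT x:open_exterior|lborel. (norm (gradient_within v open_exterior x))\<^sup>2 - deriv f (u x) * (v x)\<^sup>2) =
     (LINT x:open_exterior|lborel. (norm (gradient_within v open_exterior x))\<^sup>2 + c / (norm x)\<^sup>2 * (v x)\<^sup>2)"
    for v :: "real ^ 'n \<Rightarrow> real"
    using assms open_open_exterior[where 'a = "real ^ 'n"]
    by (intro set_lebesgue_integral_cong) (auto simp: deriv_f_alpha_u_alpha c_def)
  then have stable: "stable_solution f u \<longleftrightarrow> (\<forall>v :: real ^ 'n \<Rightarrow> real. test_function v \<longrightarrow>
      0 \<le> (LINT x:open_exterior|lborel.
        (norm (gradient_within v open_exterior x))\<^sup>2 + c / (norm x)\<^sup>2 * (v x)\<^sup>2))"
    using sol by (simp add: stable_solution_def)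
  have "stable_solution f u \<longleftrightarrow> 0 \<le> c + ((real N - 2) / 2)\<^sup>2"
    unfolding stable
    using test_function_nonneg[where 'a = "real ^ 'n" and c = c]
      ex_test_function_neg[where 'a = "real ^ 'n" and c = c]
    unfolding N by (meson not_le)
  \<comment> \<open>Completing the square in \<alpha> turns the Hardy condition into a lower bound
    sqrt (N - 1) for the distance from \<alpha> to 2 - N/2.\<close>
  also have "c + ((real N - 2) / 2)\<^sup>2 = (\<alpha> + real N / 2 - 2)\<^sup>2 - (sqrt (real N - 1))\<^sup>2"
    using assms(2) by (simp add: c_def power2_eq_square field_simps)
  also have "0 \<le> \<dots> \<longleftrightarrow> sqrt (real N - 1) \<le> \<bar>\<alpha> + real N / 2 - 2\<bar>"
    using assms(2) abs_le_square_iff[of "sqrt (real N - 1)" "\<alpha> + real N / 2 - 2"] by simp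
  also have "\<dots> \<longleftrightarrow> \<alpha> \<ge> - real N / 2 + sqrt (real N - 1) + 2 \<or>
       \<alpha> \<le> - real N / 2 - sqrt (real N - 1) + 2"
    by (auto simp: abs_real_def)
  finally show ?thesis
    using sol f_alpha_C1 assms(4) by simp
qed

end
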